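(* Let $p$ be a prime, $n>0$, and let $f \in \mathbb{F}_p[x_1,\ldots,x_n]$ be a polynomial of degree at most $n$. (a) The number of points $\vec v \in \mathbb{F}_p^n$ with $f(\vec v)=0$ is congruent mod $p$ to $(-1)^{n-1}\,\mathrm{Tr}(f^{p-1})$. (b) If this number is not a multiple of $p$, then some $\mathbb{F}_p$-multiple of $\mathrm{Tr}(f^{p-1}\bullet)$ defines a Frobenius splitting on $\mathbb{F}_p[x_1,\ldots,x_n]$, with respect to which the ideal $\langle f\rangle$ is compatibly split. (In this case $\deg f$ is equal to $n$.) (c) If $f=\prod_{i=1}^m f_i$ where each $\deg f_i>0$, then the number of points $\vec v\in\mathbb{F}_p^n$ with $f_1(\vec v)=f_2(\vec v)=\cdots=f_m(\vec v)=0$ is congruent mod $p$ to $(-1)^{n-m}\,\mathrm{Tr}(f^{p-1})$. (d) In particular, if the number of $\mathbb{F}_p$-points of $\{f=0\}$ (or of $\{f_1=\cdots=f_m=0\}$, if $f$ factors as in (c)) is not a multiple of $p$, then every ideal that can be constructed from the ideal $\langle f\rangle$ by taking prime components, sums, and intersections, and iterating these operations, is radical.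
   Context: A near-splitting of a commutative $\mathbb{F}_p$-algebra $R$ is a map $\varphi:R\to R$ with $\varphi(a+b)=\varphi(a)+\varphi(b)$ and $\varphi(a^pb)=a\,\varphi(b)$ for all $a,b\in R$. It is a (Frobenius) splitting if moreover $\varphi(1)=1$. An ideal $I\le R$ is compatibly split by the splitting $\varphi$ if $\varphi(I)\subseteq I$. $\mathrm{Tr}(\bullet)$ denotes the unique near-splitting of $\mathbb{F}_p[x_1,\ldots,x_n]$ whose value on each monomial $m$ is $\mathrm{Tr}(m)=\sqrt[p]{m\prod_i x_i}\,\big/\prod_i x_i$ if $m\prod_i x_i$ is a $p$th power, and $\mathrm{Tr}(m)=0$ otherwise. For a polynomial $h$, $\mathrm{Tr}(h\bullet)$ denotes the near-splitting $g\mapsto \mathrm{Tr}(hg)$. When $\deg f\le n$, $\mathrm{Tr}(f^{p-1})$ is an element of $\mathbb{F}_p$. The prime components of a radical ideal are its minimal primes. *)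

theory Defs
  imports
    "HOL-Library.Poly_Mapping"
    "HOL-Algebra.Ideal"
    "Berlekamp_Zassenhaus.Finite_Field"
begin

section \<open>Polynomials over the prime field\<close>

text \<open>
  The field with \<open>p\<close> elements is \<open>'p mod_ring\<close>, where \<open>p = CARD('p)\<close>. The variables are indexed
  by a finite type \<open>'n\<close>, so that \<open>n = CARD('n)\<close>. An exponent vector is an element of \<open>'n \<Rightarrow>\<^sub>0 nat\<close>,
  and a polynomial maps exponent vectors to coefficients.
\<close>

type_synonym ('n, 'p) fpoly = "('n \<Rightarrow>\<^sub>0 nat) \<Rightarrow>\<^sub>0 'p mod_ring"

definition Const :: "'p::prime_card mod_ring \<Rightarrow> ('n::finite, 'p) fpoly"
  where "Const c = Poly_Mapping.single 0 c"

definition Monom :: "('n::finite \<Rightarrow>\<^sub>0 nat) \<Rightarrow> ('n, 'p::prime_card) fpoly"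
  where "Monom m = Poly_Mapping.single m 1"

definition Var :: "'n::finite \<Rightarrow> ('n, 'p::prime_card) fpoly"
  where "Var i = Monom (Poly_Mapping.single i 1)"

text \<open>The total degree; the zero polynomial gets degree 0.\<close>

definition total_degree :: "('n::finite, 'p::prime_card) fpoly \<Rightarrow> nat"
  where "total_degree f =
    Max (insert 0 ((\<lambda>m. \<Sum>i\<in>UNIV. Poly_Mapping.lookup m i) ` Poly_Mapping.keys f))"

definition eval_at :: "('n::finite \<Rightarrow> 'p::prime_card mod_ring) \<Rightarrow> ('n, 'p) fpoly \<Rightarrow> 'p mod_ring"
  where "eval_at v f =
    (\<Sum>m\<in>Poly_Mapping.keys f. Poly_Mapping.lookup f m * (\<Prod>i\<in>UNIV. v i ^ Poly_Mapping.lookup m i))"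


section \<open>Ideals\<close>

text \<open>A type-class ring as a ring in the sense of HOL-Algebra, for its ideal theory.\<close>

definition ring_of_type :: "'a::comm_ring_1 ring"
  where "ring_of_type = \<lparr>carrier = UNIV, monoid.mult = (*), one = 1, zero = 0, add = (+)\<rparr>"

lemma cring_ring_of_type: "cring (ring_of_type :: 'a::comm_ring_1 ring)"
proof -
  have *: "\<exists>y. x + y = 0" for x :: 'a
    by (rule exI[of _ "- x"]) simp
  show ?thesis
    by unfold_locales (auto simp: ring_of_type_def Units_def algebra_simps *)
qed

definition principal_ideal_of :: "'a::comm_ring_1 \<Rightarrow> 'a set"
  where "principal_ideal_of f = genideal ring_of_type {f}"

definition radical_ideal :: "'a::comm_ring_1 set \<Rightarrow> bool"
  where "radical_ideal I \<longleftrightarrow> ideal I ring_of_type \<and> (\<forall>a k. a ^ k \<in> I \<longrightarrow> a \<in> I)"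

definition minimal_prime_over :: "'a::comm_ring_1 set \<Rightarrow> 'a set \<Rightarrow> bool"
  where "minimal_prime_over I P \<longleftrightarrow>
    primeideal P ring_of_type \<and> I \<subseteq> P \<and>
    (\<forall>Q. primeideal Q ring_of_type \<and> I \<subseteq> Q \<and> Q \<subseteq> P \<longrightarrow> Q = P)"

text \<open>
  Prime components are taken of any ideal reached, without requiring it to be radical; this can
  only enlarge the collection.
\<close>

inductive constructible :: "'a::comm_ring_1 set \<Rightarrow> 'a set \<Rightarrow> bool" for I\<^sub>0
  where
    start: "constructible I\<^sub>0 I\<^sub>0"
  | component: "constructible I\<^sub>0 I \<Longrightarrow> minimal_prime_over I P \<Longrightarrow> constructible I\<^sub>0 P"
  | sum: "constructible I\<^sub>0 I \<Longrightarrow> constructible I\<^sub>0 J \<Longrightarrow> constructible I\<^sub>0 (I <+>\<^bsub>ring_of_type\<^esub> J)"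
  | inter: "constructible I\<^sub>0 I \<Longrightarrow> constructible I\<^sub>0 J \<Longrightarrow> constructible I\<^sub>0 (I \<inter> J)"


section \<open>Near-splittings\<close>

definition near_splitting :: "nat \<Rightarrow> ('a::comm_ring_1 \<Rightarrow> 'a) \<Rightarrow> bool"
  where "near_splitting p \<phi> \<longleftrightarrow>
    (\<forall>a b. \<phi> (a + b) = \<phi> a + \<phi> b) \<and> (\<forall>a b. \<phi> (a ^ p * b) = a * \<phi> b)"

definition splitting :: "nat \<Rightarrow> ('a::comm_ring_1 \<Rightarrow> 'a) \<Rightarrow> bool"
  where "splitting p \<phi> \<longleftrightarrow> near_splitting p \<phi> \<and> \<phi> 1 = 1"

definition compatibly_split :: "('a::comm_ring_1 \<Rightarrow> 'a) \<Rightarrow> 'a set \<Rightarrow> bool"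
  where "compatibly_split \<phi> I \<longleftrightarrow> ideal I ring_of_type \<and> \<phi> ` I \<subseteq> I"

text \<open>
  The values on monomials: \<open>\<phi> m\<close> is the quotient by the product of the variables of the \<open>p\<close>-th
  root of \<open>m\<close> times that product, if the root exists, and 0 otherwise.
\<close>

definition trace_on_monomials :: "(('n::finite, 'p::prime_card) fpoly \<Rightarrow> ('n, 'p) fpoly) \<Rightarrow> bool"
  where "trace_on_monomials \<phi> \<longleftrightarrow>
    (\<forall>m q. Monom m * (\<Prod>i\<in>UNIV. Var i) = q ^ CARD('p) \<longrightarrow>
       \<phi> (Monom m) * (\<Prod>i\<in>UNIV. Var i) = q) \<and>
    (\<forall>m. (\<nexists>q. Monom m * (\<Prod>i\<in>UNIV. Var i) = (q :: ('n, 'p) fpoly) ^ CARD('p)) \<longrightarrow>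
       \<phi> (Monom m) = 0)"

definition Tr :: "('n::finite, 'p::prime_card) fpoly \<Rightarrow> ('n, 'p) fpoly"
  where "Tr = (THE \<phi>. near_splitting CARD('p) \<phi> \<and> trace_on_monomials \<phi>)"


subsection \<open>The trace is well defined\<close>

definition ones :: "'n::finite \<Rightarrow>\<^sub>0 nat"
  where "ones = (\<Sum>i\<in>UNIV. Poly_Mapping.single i 1)"

lemma lookup_ones [simp]: "Poly_Mapping.lookup ones i = 1"
  by (simp add: ones_def lookup_sum lookup_single when_def)

definition scale_exp :: "nat \<Rightarrow> ('n::finite \<Rightarrow>\<^sub>0 nat) \<Rightarrow> 'n \<Rightarrow>\<^sub>0 nat"
  where "scale_exp c m = Poly_Mapping.map ((*) c) m"

lemma lookup_scale_exp [simp]: "Poly_Mapping.lookup (scale_exp c m) i = c * Poly_Mapping.lookup m i"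
  by (simp add: scale_exp_def Poly_Mapping.map.rep_eq when_def)

lemma prod_Var: "(\<Prod>i\<in>UNIV. Var i) = (Monom ones :: ('n::finite, 'p::prime_card) fpoly)"
proof -
  have "(\<Prod>i\<in>A. Var i) = (Monom (\<Sum>i\<in>A. Poly_Mapping.single i 1) :: ('n, 'p) fpoly)"
    if "finite A" for A
    using that by (induction A) (simp_all add: Var_def Monom_def mult_single)
  then show ?thesis by (simp add: ones_def)
qed

lemma fpoly_expansion:
  fixes f :: "('n::finite, 'p::prime_card) fpoly"
  shows "f = (\<Sum>m\<in>Poly_Mapping.keys f. Const (Poly_Mapping.lookup f m) * Monom m)"
proof (rule poly_mapping_eqI)
  fix k
  have "(\<Sum>m\<in>Poly_Mapping.keys f. Poly_Mapping.lookup (Const (Poly_Mapping.lookup f m) * Monom m) k)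
      = (\<Sum>m\<in>Poly_Mapping.keys f. if m = k then Poly_Mapping.lookup f m else 0)"
    by (intro sum.cong) (auto simp: Const_def Monom_def mult_single lookup_single when_def)
  then show "Poly_Mapping.lookup f k = Poly_Mapping.lookup (\<Sum>m\<in>Poly_Mapping.keys f. Const (Poly_Mapping.lookup f m) * Monom m) k"
    by (auto simp: lookup_sum in_keys_iff)
qed

lemma lookup_single_mult:
  fixes f :: "('n::finite, 'p::prime_card) fpoly"
  shows "Poly_Mapping.lookup (Poly_Mapping.single a c * f) (a + k) = c * Poly_Mapping.lookup f k"
    and "(\<And>d. k \<noteq> a + d) \<Longrightarrow> Poly_Mapping.lookup (Poly_Mapping.single a c * f) k = 0"
proof -
  have *: "Poly_Mapping.single a c * f
      = (\<Sum>m\<in>Poly_Mapping.keys f. Poly_Mapping.single (a + m) (c * Poly_Mapping.lookup f m))"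
    by (subst fpoly_expansion[of f])
       (simp add: Const_def Monom_def mult_single sum_distrib_left)
  have "Poly_Mapping.lookup (Poly_Mapping.single a c * f) (a + k)
      = (\<Sum>m\<in>Poly_Mapping.keys f. if m = k then c * Poly_Mapping.lookup f m else 0)"
    unfolding * lookup_sum by (intro sum.cong) (auto simp: lookup_single when_def)
  then show "Poly_Mapping.lookup (Poly_Mapping.single a c * f) (a + k) = c * Poly_Mapping.lookup f k"
    by (auto simp: in_keys_iff)
  show "Poly_Mapping.lookup (Poly_Mapping.single a c * f) k = 0" if "\<And>d. k \<noteq> a + d"
    unfolding * lookup_sum using that
    by (intro sum.neutral) (auto simp: lookup_single when_def)
qed

lemma exp_decompose:
  fixes a k :: "'n::finite \<Rightarrow>\<^sub>0 nat"
  assumes "\<And>i. Poly_Mapping.lookup a i \<le> Poly_Mapping.lookup k i"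
  shows "k = a + (k - a)"
  using assms by (intro poly_mapping_eqI) (simp add: lookup_add lookup_minus)

lemma prime_CHAR_fpoly:
  "CHAR(('n::finite, 'p::prime_card) fpoly) = CARD('p)"
proof (rule CHAR_eqI)
  show "of_nat CARD('p) = (0 :: ('n, 'p) fpoly)"
    by (simp flip: single_of_nat)
next
  fix x assume "of_nat x = (0 :: ('n, 'p) fpoly)"
  then have "(of_nat x :: 'p mod_ring) = 0"
    by (metis lookup_single_eq lookup_zero single_of_nat)
  then show "CARD('p) dvd x" by (simp add: of_nat_0_mod_ring_dvd)
qed

lemma frobenius_add:
  fixes a b :: "('n::finite, 'p::prime_card) fpoly"
  shows "(a + b) ^ CARD('p) = a ^ CARD('p) + b ^ CARD('p)"
  by (rule freshmans_dream) (simp_all add: prime_CHAR_fpoly prime_card)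

lemma fermat_mod_ring: "(c :: 'p::prime_card mod_ring) ^ CARD('p) = c"
  using finite_field_power_card_eq_same[of c] by simp

lemma single_power:
  "Poly_Mapping.single m (c :: 'p::prime_card mod_ring) ^ k
     = Poly_Mapping.single (scale_exp k (m :: 'n::finite \<Rightarrow>\<^sub>0 nat)) (c ^ k)"
proof (induction k)
  case 0
  have "scale_exp 0 m = 0" by (rule poly_mapping_eqI) simp
  then show ?case by simp
next
  case (Suc k)
  have "m + scale_exp k m = scale_exp (Suc k) m"
    by (rule poly_mapping_eqI) (simp add: lookup_add)
  with Suc show ?case by (simp add: mult_single)
qed

lemma fpoly_additive_induct:
  fixes P :: "('n::finite, 'p::prime_card) fpoly \<Rightarrow> bool"
  assumes "P 0" "\<And>m c. P (Poly_Mapping.single m c)" "\<And>f g. P f \<Longrightarrow> P g \<Longrightarrow> P (f + g)"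
  shows "P f"
proof -
  have "P (\<Sum>m\<in>A. Const (Poly_Mapping.lookup f m) * Monom m)" if "finite A" for A
    using that by induction (auto simp: assms Const_def Monom_def mult_single)
  then show ?thesis by (subst fpoly_expansion) simp
qed

lemma lookup_frobenius:
  fixes q :: "('n::finite, 'p::prime_card) fpoly"
  shows "Poly_Mapping.lookup (q ^ CARD('p)) (scale_exp CARD('p) k) = Poly_Mapping.lookup q k"
proof (induction q rule: fpoly_additive_induct)
  case 1
  then show ?case by (simp add: zero_power)
next
  case (2 m c)
  have "scale_exp CARD('p) m = scale_exp CARD('p) k \<longleftrightarrow> m = k"
    by (auto simp: poly_mapping_eq_iff fun_eq_iff dest!: fun_cong)
  then show ?case
    by (auto simp: single_power fermat_mod_ring lookup_single when_def)
next
  case (3 f g)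
  then show ?case by (simp add: frobenius_add lookup_add)
qed

definition trace_exp :: "nat \<Rightarrow> ('n::finite \<Rightarrow>\<^sub>0 nat) \<Rightarrow> 'n \<Rightarrow>\<^sub>0 nat"
  where "trace_exp p k = scale_exp p k + scale_exp (p - 1) ones"

lemma trace_exp_plus: "p > 0 \<Longrightarrow> trace_exp p k + ones = scale_exp p (k + ones)"
  by (rule poly_mapping_eqI) (simp add: trace_exp_def lookup_add algebra_simps)

lemma trace_exp_add: "trace_exp p (m + k) = scale_exp p m + trace_exp p k"
  by (rule poly_mapping_eqI) (simp add: trace_exp_def lookup_add algebra_simps)

lemma inj_trace_exp:
  assumes "p > 0"
  shows "inj (trace_exp p)"
proof (rule injI)
  fix k l :: "'n::finite \<Rightarrow>\<^sub>0 nat"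
  assume eq: "trace_exp p k = trace_exp p l"
  show "k = l"
  proof (rule poly_mapping_eqI)
    fix i
    have "p * Poly_Mapping.lookup k i + (p - 1) = p * Poly_Mapping.lookup l i + (p - 1)"
      using arg_cong[OF eq, of "\<lambda>h. Poly_Mapping.lookup h i"]
      by (simp add: trace_exp_def lookup_add)
    then show "Poly_Mapping.lookup k i = Poly_Mapping.lookup l i"
      using assms by (simp only: add_right_cancel mult_cancel1) simp
  qed
qed

definition trace_map :: "('n::finite, 'p::prime_card) fpoly \<Rightarrow> ('n, 'p) fpoly"
  where "trace_map g = Abs_poly_mapping (\<lambda>k. Poly_Mapping.lookup g (trace_exp CARD('p) k))"

lemma lookup_trace_map:
  fixes g :: "('n::finite, 'p::prime_card) fpoly"
  shows "Poly_Mapping.lookup (trace_map g) k = Poly_Mapping.lookup g (trace_exp CARD('p) k)"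
proof -
  have "finite (trace_exp CARD('p) -` {k. Poly_Mapping.lookup g k \<noteq> 0})"
    by (rule finite_vimageI[OF finite_lookup inj_trace_exp]) simp
  then show ?thesis by (simp add: trace_map_def vimage_def)
qed

lemma near_splitting_trace_map:
  "near_splitting CARD('p) (trace_map :: ('n::finite, 'p::prime_card) fpoly \<Rightarrow> ('n, 'p) fpoly)"
proof -
  have add: "trace_map (a + b) = trace_map a + trace_map b" for a b :: "('n, 'p) fpoly"
    by (rule poly_mapping_eqI) (simp add: lookup_trace_map lookup_add)
  have "trace_map (a ^ CARD('p) * b) = a * trace_map b" for a b :: "('n, 'p) fpoly"
  proof (induction a rule: fpoly_additive_induct)
    case 1
    show ?case by (rule poly_mapping_eqI) (simp add: lookup_trace_map zero_power)
  next
    case (2 m c)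
    show ?case
    proof (rule poly_mapping_eqI)
      fix k
      show "Poly_Mapping.lookup (trace_map (Poly_Mapping.single m c ^ CARD('p) * b)) k
          = Poly_Mapping.lookup (Poly_Mapping.single m c * trace_map b) k"
      proof (cases "\<exists>d. k = m + d")
        case True
        then obtain d where "k = m + d" ..
        then show ?thesis
          by (simp add: lookup_trace_map single_power fermat_mod_ring trace_exp_add
              lookup_single_mult)
      next
        case False
        have "trace_exp CARD('p) k \<noteq> scale_exp CARD('p) m + d" for d
        proof
          assume eq: "trace_exp CARD('p) k = scale_exp CARD('p) m + d"
          have "Poly_Mapping.lookup m i \<le> Poly_Mapping.lookup k i" for i
          proof -
            have "CARD('p) * Poly_Mapping.lookup m i \<le> CARD('p) * Poly_Mapping.lookup k i + (CARD('p) - 1)"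
              using arg_cong[OF eq, of "\<lambda>h. Poly_Mapping.lookup h i"]
              by (simp add: trace_exp_def lookup_add)
            also have "\<dots> < CARD('p) * (Poly_Mapping.lookup k i + 1)"
              by (simp add: algebra_simps)
            finally have "Poly_Mapping.lookup m i < Poly_Mapping.lookup k i + 1"
              by (simp only: mult_less_cancel1)
            then show ?thesis by simp
          qed
          with False show False using exp_decompose by blast
        qed
        then have "Poly_Mapping.lookup (Poly_Mapping.single (scale_exp CARD('p) m) c * b) (trace_exp CARD('p) k) = 0"
          by (rule lookup_single_mult(2))
        moreover have "Poly_Mapping.lookup (Poly_Mapping.single m c * trace_map b) k = 0"
          using False by (intro lookup_single_mult(2)) blast
        ultimately show ?thesis
          by (simp add: lookup_trace_map single_power fermat_mod_ring)
      qed
    qed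
  next
    case (3 f g)
    then show ?case by (simp add: frobenius_add add distrib_right)
  qed
  with add show ?thesis by (simp add: near_splitting_def)
qed

lemma trace_on_monomials_trace_map:
  "trace_on_monomials (trace_map :: ('n::finite, 'p::prime_card) fpoly \<Rightarrow> ('n, 'p) fpoly)"
  unfolding trace_on_monomials_def prod_Var
proof (intro conjI allI impI)
  fix m and q :: "('n, 'p) fpoly"
  assume "Monom m * Monom ones = q ^ CARD('p)"
  then have "q ^ CARD('p) = Monom (m + ones)"
    by (simp add: Monom_def mult_single)
  then have q: "Poly_Mapping.lookup q k = Poly_Mapping.lookup (Monom (m + ones) :: ('n, 'p) fpoly) (scale_exp CARD('p) k)" for k
    using lookup_frobenius[of q k] by simp
  show "trace_map (Monom m) * Monom ones = q"
  proof (rule poly_mapping_eqI)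
    fix k
    show "Poly_Mapping.lookup (trace_map (Monom m) * Monom ones) k = Poly_Mapping.lookup q k"
    proof (cases "\<exists>d. k = ones + d")
      case True
      then obtain d where k: "k = ones + d" ..
      have "m + ones = scale_exp CARD('p) (d + ones) \<longleftrightarrow> m = trace_exp CARD('p) d"
        using trace_exp_plus[of "CARD('p)" d] add_right_cancel[of m ones "trace_exp CARD('p) d"]
        by simp
      then have "Poly_Mapping.lookup q k = Poly_Mapping.lookup (trace_map (Monom m :: ('n, 'p) fpoly)) d"
        unfolding q k lookup_trace_map Monom_def lookup_single add.commute[of ones d]
        by (simp only:)
      moreover have "Poly_Mapping.lookup (trace_map (Monom m) * Monom ones) k
          = Poly_Mapping.lookup (trace_map (Monom m :: ('n, 'p) fpoly)) d"
        unfolding k Monom_def mult.commute[of _ "Poly_Mapping.single ones 1"] lookup_single_mult(1)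
        by simp
      ultimately show ?thesis by simp
    next
      case False
      have "m + ones \<noteq> scale_exp CARD('p) k"
      proof
        assume eq: "m + ones = scale_exp CARD('p) k"
        have "Poly_Mapping.lookup ones i \<le> Poly_Mapping.lookup k i" for i
          using arg_cong[OF eq, of "\<lambda>h. Poly_Mapping.lookup h i"]
          by (cases "Poly_Mapping.lookup k i") (simp_all add: lookup_add)
        with False show False using exp_decompose by blast
      qed
      moreover have "Poly_Mapping.lookup (Poly_Mapping.single ones 1 * trace_map (Monom m :: ('n, 'p) fpoly)) k = 0"
        using False by (intro lookup_single_mult(2)) blast
      ultimately show ?thesis
        by (simp add: q Monom_def mult.commute lookup_single when_def)
    qed
  qed
next
  fix m :: "'n \<Rightarrow>\<^sub>0 nat"
  assume no: "\<nexists>q :: ('n, 'p) fpoly. Monom m * Monom ones = q ^ CARD('p)"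
  show "trace_map (Monom m :: ('n, 'p) fpoly) = 0"
  proof (rule poly_mapping_eqI)
    fix k
    have "m \<noteq> trace_exp CARD('p) k"
    proof
      assume "m = trace_exp CARD('p) k"
      then have "Monom m * Monom ones = (Monom (k + ones) :: ('n, 'p) fpoly) ^ CARD('p)"
        by (simp add: Monom_def mult_single single_power trace_exp_plus)
      with no show False by blast
    qed
    then show "Poly_Mapping.lookup (trace_map (Monom m :: ('n, 'p) fpoly)) k = Poly_Mapping.lookup 0 k"
      by (simp add: lookup_trace_map Monom_def lookup_single when_def)
  qed
qed

lemma trace_on_monomialsD:
  fixes \<phi> :: "('n::finite, 'p::prime_card) fpoly \<Rightarrow> ('n, 'p) fpoly"
  assumes "trace_on_monomials \<phi>"
  shows "Monom m * Monom ones = q ^ CARD('p) \<Longrightarrow> \<phi> (Monom m) * Monom ones = q"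
    and "\<nexists>q :: ('n, 'p) fpoly. Monom m * Monom ones = q ^ CARD('p) \<Longrightarrow> \<phi> (Monom m) = 0"
  using assms unfolding trace_on_monomials_def prod_Var by simp_all

lemma trace_unique:
  fixes \<phi> :: "('n::finite, 'p::prime_card) fpoly \<Rightarrow> ('n, 'p) fpoly"
  assumes "near_splitting CARD('p) \<phi>" "trace_on_monomials \<phi>"
    and "near_splitting CARD('p) \<psi>" "trace_on_monomials \<psi>"
  shows "\<phi> = \<psi>"
proof
  fix f
  have cancel: "a = b" if "a * Monom ones = b * Monom ones" for a b :: "('n, 'p) fpoly"
  proof (rule poly_mapping_eqI)
    fix k
    show "Poly_Mapping.lookup a k = Poly_Mapping.lookup b k"
      using arg_cong[OF that, of "\<lambda>h. Poly_Mapping.lookup h (ones + k)"]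
        lookup_single_mult(1)[of ones 1 a k] lookup_single_mult(1)[of ones 1 b k]
      by (simp add: Monom_def mult.commute)
  qed
  have mono: "\<phi> (Monom m) = \<psi> (Monom m)" for m
  proof (cases "\<exists>q :: ('n, 'p) fpoly. Monom m * Monom ones = q ^ CARD('p)")
    case True
    then obtain q :: "('n, 'p) fpoly" where "Monom m * Monom ones = q ^ CARD('p)" ..
    then have "\<phi> (Monom m) * Monom ones = q" "\<psi> (Monom m) * Monom ones = q"
      by (rule trace_on_monomialsD(1)[OF assms(2)], rule trace_on_monomialsD(1)[OF assms(4)])
    then show ?thesis by (rule cancel[OF trans[OF _ sym]])
  next
    case False
    then show ?thesis
      using trace_on_monomialsD(2)[OF assms(2)] trace_on_monomialsD(2)[OF assms(4)] by simp
  qed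
  have single: "\<phi> (Poly_Mapping.single m c) = \<psi> (Poly_Mapping.single m c)" for m c
  proof -
    have "scale_exp CARD('p) (0 :: 'n \<Rightarrow>\<^sub>0 nat) = 0" by (rule poly_mapping_eqI) simp
    then have "Poly_Mapping.single m c = Const c ^ CARD('p) * Monom m"
      by (simp add: Const_def Monom_def single_power fermat_mod_ring mult_single)
    then show ?thesis using assms(1,3) mono by (simp add: near_splitting_def)
  qed
  show "\<phi> f = \<psi> f"
  proof (induction f rule: fpoly_additive_induct)
    case 1
    show ?case using single[of 0 0] by simp
  next
    case (2 m c)
    show ?case by (rule single)
  next
    case (3 f g)
    then show ?case using assms(1,3) by (simp add: near_splitting_def)
  qed
qed

theorem ex1_trace:
  "\<exists>!\<phi> :: ('n::finite, 'p::prime_card) fpoly \<Rightarrow> ('n, 'p) fpoly.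
     near_splitting CARD('p) \<phi> \<and> trace_on_monomials \<phi>"
  using near_splitting_trace_map trace_on_monomials_trace_map
  by (intro ex1I[of _ trace_map] conjI) (auto intro: trace_unique)

lemma Tr_eq_trace_map: "Tr = (trace_map :: ('n::finite, 'p::prime_card) fpoly \<Rightarrow> ('n, 'p) fpoly)"
  unfolding Tr_def
  by (rule the1_equality[OF ex1_trace])
     (simp add: near_splitting_trace_map trace_on_monomials_trace_map)

end

theory Submission
  imports Defs
begin

text \<open>
  The point counts are a refinement of the argument of Chevalley and Warning. By Fermat's little
  theorem \<open>\<Prod>i. (1 - f\<^sub>i^(p-1))\<close> is the indicator function of the common zeros of the \<open>f\<^sub>i\<close>, so
  modulo \<open>p\<close> the number of these zeros is a sum of values of polynomials over the whole affine space.
  The sum of the values of a monomial factors into power sums over the prime field; if the degree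
  is at most \<open>n (p - 1)\<close>, only the monomial with all exponents \<open>p - 1\<close> survives, and it gives \<open>(-1)^n\<close>
  (\<open>sum_of_low_degree_monomial_values\<close>). Its coefficient is the constant term of the trace. When the
  indicator function is expanded, every product over a proper subset of the factors has degree below
  \<open>n\<close>, because degrees add, and contributes nothing; what is left is the term of \<open>f^(p-1)\<close>
  (\<open>card_common_zeros\<close>). The first count is the case of a single factor.

  For \<open>deg f \<le> n\<close> the polynomial \<open>Tr (f^(p-1))\<close> is a constant \<open>t\<close>, and \<open>t = 0\<close> if \<open>deg f < n\<close>.
  A point count prime to \<open>p\<close> makes \<open>t\<close> nonzero, and then \<open>\<phi> = t\<inverse> Tr (f^(p-1) \<bullet>)\<close> maps 1 to 1, while
  \<open>\<phi> (r f) = f t\<inverse> Tr r\<close> shows that it preserves the ideal of \<open>f\<close>.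

  A compatibly split ideal is radical, since \<open>a^p \<in> I\<close> gives \<open>a = \<phi> (a^p) \<in> I\<close>. Hence it suffices that
  compatible splitting passes to sums and intersections, which is immediate, and to minimal primes
  (\<open>compatibly_split_minimal_prime\<close>).
\<close>

section \<open>Total degree\<close>

definition exp_degree :: "('n::finite \<Rightarrow>\<^sub>0 nat) \<Rightarrow> nat"
  where "exp_degree m = (\<Sum>i\<in>UNIV. Poly_Mapping.lookup m i)"

lemma exp_degree_add: "exp_degree (a + b) = exp_degree a + exp_degree b"
  by (simp add: exp_degree_def lookup_add sum.distrib)

lemma exp_degree_zero [simp]: "exp_degree 0 = 0"
  by (simp add: exp_degree_def)

lemma exp_degree_trace_exp:
  "exp_degree (trace_exp p (k :: 'n::finite \<Rightarrow>\<^sub>0 nat)) = p * exp_degree k + CARD('n) * (p - 1)"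
  by (simp add: exp_degree_def trace_exp_def lookup_add sum.distrib sum_distrib_left)

lemma exp_degree_eq_0_iff: "exp_degree m = 0 \<longleftrightarrow> m = 0"
  by (auto simp: exp_degree_def intro: poly_mapping_eqI)

lemma total_degree_le_iff:
  "total_degree f \<le> d \<longleftrightarrow> (\<forall>m. Poly_Mapping.lookup f m \<noteq> 0 \<longrightarrow> exp_degree m \<le> d)"
  by (auto simp: total_degree_def exp_degree_def in_keys_iff)

lemma exp_degree_le_total_degree:
  "Poly_Mapping.lookup f m \<noteq> 0 \<Longrightarrow> exp_degree m \<le> total_degree f"
  using total_degree_le_iff by blast

lemma total_degree_attained:
  assumes "f \<noteq> 0"
  obtains m where "Poly_Mapping.lookup f m \<noteq> 0" "exp_degree m = total_degree f"
proof -
  let ?D = "exp_degree ` Poly_Mapping.keys f"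
  have ne: "?D \<noteq> {}" using assms by simp
  then have "Max ?D \<in> ?D" by (intro Max_in) auto
  moreover have "total_degree f = Max ?D"
    using ne by (simp add: total_degree_def flip: exp_degree_def)
  ultimately show thesis using that by (auto simp: in_keys_iff)
qed

lemma lookup_mult_eq_sum:
  fixes f g :: "('n::finite, 'p::prime_card) fpoly"
  shows "Poly_Mapping.lookup (f * g) k = (\<Sum>(a, b)\<in>Poly_Mapping.keys f \<times> Poly_Mapping.keys g.
    if a + b = k then Poly_Mapping.lookup f a * Poly_Mapping.lookup g b else 0)"
proof -
  have "f * g = (\<Sum>a\<in>Poly_Mapping.keys f. \<Sum>b\<in>Poly_Mapping.keys g.
      Poly_Mapping.single (a + b) (Poly_Mapping.lookup f a * Poly_Mapping.lookup g b))"
    by (subst fpoly_expansion[of f], subst fpoly_expansion[of g])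
       (simp add: Const_def Monom_def mult_single sum_product)
  then show ?thesis
    by (simp add: lookup_sum lookup_single when_def flip: sum.cartesian_product)
qed

lemma total_degree_mult_le:
  fixes f g :: "('n::finite, 'p::prime_card) fpoly"
  shows "total_degree (f * g) \<le> total_degree f + total_degree g"
  unfolding total_degree_le_iff
proof (intro allI impI)
  fix k assume "Poly_Mapping.lookup (f * g) k \<noteq> 0"
  then obtain x where "x \<in> Poly_Mapping.keys f \<times> Poly_Mapping.keys g"
    "(case x of (a, b) \<Rightarrow> if a + b = k then Poly_Mapping.lookup f a * Poly_Mapping.lookup g b else 0) \<noteq> 0"
    unfolding lookup_mult_eq_sum by (rule sum.not_neutral_contains_not_neutral)
  then obtain a b where "k = a + b" "Poly_Mapping.lookup f a \<noteq> 0" "Poly_Mapping.lookup g b \<noteq> 0"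
    by (auto simp: in_keys_iff split: if_splits)
  then show "exp_degree k \<le> total_degree f + total_degree g"
    by (simp add: exp_degree_add add_mono exp_degree_le_total_degree)
qed

lemma total_degree_one [simp]: "total_degree (1 :: ('n::finite, 'p::prime_card) fpoly) = 0"
proof -
  have "total_degree (1 :: ('n, 'p) fpoly) \<le> 0"
    unfolding total_degree_le_iff by (auto simp: lookup_one when_def)
  then show ?thesis by simp
qed

lemma total_degree_zero [simp]: "total_degree (0 :: ('n::finite, 'p::prime_card) fpoly) = 0"
  by (simp add: total_degree_def)

lemma total_degree_power_le:
  fixes f :: "('n::finite, 'p::prime_card) fpoly"
  shows "total_degree (f ^ k) \<le> k * total_degree f"
proof (induction k)
  case (Suc k)
  then show ?case using total_degree_mult_le[of f "f ^ k"] by simp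
qed simp

text \<open>
  A monomial order on a finite unordered set of variables: numbering the variables embeds the
  exponent vectors additively into finitely supported functions on the natural numbers, which are
  ordered lexicographically and compatibly with addition.
\<close>

lemma ex_additive_embedding_into_ordered:
  "\<exists>h :: ('n::finite \<Rightarrow>\<^sub>0 nat) \<Rightarrow> (nat \<Rightarrow>\<^sub>0 nat). inj h \<and> (\<forall>a b. h (a + b) = h a + h b)"
proof -
  obtain e :: "'n \<Rightarrow> nat" where e: "inj e"
    using finite_imp_inj_to_nat_seg[of "UNIV :: 'n set"] by auto
  define h where "h m = (\<Sum>i\<in>UNIV. Poly_Mapping.single (e i) (Poly_Mapping.lookup m i))"
    for m :: "'n \<Rightarrow>\<^sub>0 nat"
  have "Poly_Mapping.lookup (h m) (e j) = Poly_Mapping.lookup m j" for m j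
  proof -
    have "Poly_Mapping.lookup (h m) (e j) = (\<Sum>i\<in>UNIV. if i = j then Poly_Mapping.lookup m i else 0)"
      unfolding h_def lookup_sum
      by (intro sum.cong) (auto simp: lookup_single when_def inj_eq[OF e])
    then show ?thesis by simp
  qed
  then have "inj h" by (metis injI poly_mapping_eqI)
  moreover have "h (a + b) = h a + h b" for a b
    by (simp add: h_def lookup_add single_add sum.distrib)
  ultimately show ?thesis by blast
qed

text \<open>
  Among the exponents of top degree of each factor take the greatest one in a monomial order. No
  other pair of exponents has the same sum, so the product of the two coefficients survives.
\<close>

lemma total_degree_mult_ge:
  fixes f g :: "('n::finite, 'p::prime_card) fpoly"
  assumes "f \<noteq> 0" "g \<noteq> 0"
  shows "total_degree f + total_degree g \<le> total_degree (f * g)"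
proof -
  obtain h :: "('n \<Rightarrow>\<^sub>0 nat) \<Rightarrow> (nat \<Rightarrow>\<^sub>0 nat)"
    where h: "inj h" and h_add: "\<And>a b. h (a + b) = h a + h b"
    using ex_additive_embedding_into_ordered by blast
  have top: "\<exists>a. Poly_Mapping.lookup q a \<noteq> 0 \<and> exp_degree a = total_degree q \<and>
      (\<forall>b. Poly_Mapping.lookup q b \<noteq> 0 \<longrightarrow> exp_degree b = total_degree q \<longrightarrow> h b \<le> h a)"
    if "q \<noteq> 0" for q :: "('n, 'p) fpoly"
  proof -
    let ?T = "{a \<in> Poly_Mapping.keys q. exp_degree a = total_degree q}"
    have "finite ?T" "?T \<noteq> {}"
      using total_degree_attained[OF that] by (auto simp: in_keys_iff)
    then have "Max (h ` ?T) \<in> h ` ?T" and le: "\<forall>b\<in>?T. h b \<le> Max (h ` ?T)"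
      using Max_in[of "h ` ?T"] by auto
    then obtain a where "a \<in> ?T" "Max (h ` ?T) = h a" by blast
    with le have "\<forall>b\<in>?T. h b \<le> h a" by metis
    with \<open>a \<in> ?T\<close> show ?thesis by (auto simp: in_keys_iff intro!: exI[of _ a])
  qed
  obtain a where a: "Poly_Mapping.lookup f a \<noteq> 0" "exp_degree a = total_degree f"
    and a_max: "\<And>b. Poly_Mapping.lookup f b \<noteq> 0 \<Longrightarrow> exp_degree b = total_degree f \<Longrightarrow> h b \<le> h a"
    using top[OF assms(1)] by blast
  obtain b where b: "Poly_Mapping.lookup g b \<noteq> 0" "exp_degree b = total_degree g"
    and b_max: "\<And>c. Poly_Mapping.lookup g c \<noteq> 0 \<Longrightarrow> exp_degree c = total_degree g \<Longrightarrow> h c \<le> h b"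
    using top[OF assms(2)] by blast
  have unique: "a' = a \<and> b' = b"
    if "Poly_Mapping.lookup f a' \<noteq> 0" "Poly_Mapping.lookup g b' \<noteq> 0" "a' + b' = a + b" for a' b'
  proof -
    have "exp_degree a' + exp_degree b' = total_degree f + total_degree g"
      using arg_cong[OF that(3), of exp_degree] a b by (simp add: exp_degree_add)
    moreover have "exp_degree a' \<le> total_degree f" "exp_degree b' \<le> total_degree g"
      using that by (auto intro: exp_degree_le_total_degree)
    ultimately have "h a' \<le> h a" "h b' \<le> h b"
      using that by (auto intro!: a_max b_max)
    moreover have "h a' + h b' = h a + h b"
      using arg_cong[OF that(3), of h] by (simp add: h_add)
    ultimately have "h a' = h a"
      by (metis add_less_le_mono order.not_eq_order_implies_strict order_less_irrefl)
    then have "a' = a" using h by (simp add: inj_eq)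
    with that(3) show ?thesis by simp
  qed
  have "Poly_Mapping.lookup (f * g) (a + b)
      = (\<Sum>x\<in>Poly_Mapping.keys f \<times> Poly_Mapping.keys g.
          if x = (a, b) then Poly_Mapping.lookup f a * Poly_Mapping.lookup g b else 0)"
    unfolding lookup_mult_eq_sum
    by (intro sum.cong) (auto simp: in_keys_iff dest: unique split: if_splits)
  also have "\<dots> = Poly_Mapping.lookup f a * Poly_Mapping.lookup g b"
    using a b by (simp add: in_keys_iff)
  finally have "Poly_Mapping.lookup (f * g) (a + b) \<noteq> 0" using a b by simp
  then show ?thesis
    using exp_degree_le_total_degree[of "f * g" "a + b"] a b by (simp add: exp_degree_add)
qed

lemma total_degree_mult:
  fixes f g :: "('n::finite, 'p::prime_card) fpoly"
  shows "f \<noteq> 0 \<Longrightarrow> g \<noteq> 0 \<Longrightarrow> total_degree (f * g) = total_degree f + total_degree g"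
  by (simp add: le_antisym total_degree_mult_le total_degree_mult_ge)

text \<open>
  The degree formula alone gives this only for factors of positive degree, as 0 and the nonzero
  constants have the same degree.
\<close>

lemma fpoly_mult_nonzero:
  fixes f g :: "('n::finite, 'p::prime_card) fpoly"
  assumes "f \<noteq> 0" "g \<noteq> 0"
  shows "f * g \<noteq> 0"
proof -
  \<comment> \<open>Multiplying by the product of the variables makes the degrees positive, so that the
    products cannot vanish.\<close>
  have deg_pos: "total_degree q > 0 \<Longrightarrow> q \<noteq> 0" for q :: "('n, 'p) fpoly" by auto
  have X: "total_degree (Monom ones :: ('n, 'p) fpoly) > 0"
    using exp_degree_le_total_degree[of "Monom ones :: ('n, 'p) fpoly" ones]
    by (auto simp: Monom_def exp_degree_def intro: less_le_trans[OF zero_less_card_finite])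
  then have "total_degree (Monom ones * f) > 0"
    using total_degree_mult[OF deg_pos[OF X] assms(1)] by simp
  then have "total_degree (Monom ones * f * g) > 0"
    using total_degree_mult[OF deg_pos assms(2)] by simp
  then have "Monom ones * (f * g) \<noteq> 0" by (auto simp: mult.assoc)
  then show ?thesis by auto
qed

lemma total_degree_prod:
  fixes fs :: "'i \<Rightarrow> ('n::finite, 'p::prime_card) fpoly"
  assumes "finite A" "\<And>i. i \<in> A \<Longrightarrow> fs i \<noteq> 0"
  shows "total_degree (\<Prod>i\<in>A. fs i) = (\<Sum>i\<in>A. total_degree (fs i)) \<and> (\<Prod>i\<in>A. fs i) \<noteq> 0"
  using assms
  by (induction A) (auto simp: total_degree_mult fpoly_mult_nonzero)


section \<open>Evaluation and power sums\<close>

lemma eval_at_eq_sum: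
  assumes "finite A" "Poly_Mapping.keys f \<subseteq> A"
  shows "eval_at v f =
    (\<Sum>m\<in>A. Poly_Mapping.lookup f m * (\<Prod>i\<in>UNIV. v i ^ Poly_Mapping.lookup m i))"
  unfolding eval_at_def using assms
  by (intro sum.mono_neutral_left) (auto simp: in_keys_iff)

lemma eval_at_zero [simp]: "eval_at v 0 = 0"
  by (simp add: eval_at_def)

lemma eval_at_single [simp]:
  "eval_at v (Poly_Mapping.single m c) = c * (\<Prod>i\<in>UNIV. v i ^ Poly_Mapping.lookup m i)"
  by (subst eval_at_eq_sum[of "{m}"]) auto

lemma eval_at_add [simp]: "eval_at v (f + g) = eval_at v f + eval_at v g"
proof -
  let ?A = "Poly_Mapping.keys f \<union> Poly_Mapping.keys g"
  have "Poly_Mapping.keys (f + g) \<subseteq> ?A" by (rule Poly_Mapping.keys_add)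
  then show ?thesis
    by (simp add: eval_at_eq_sum[of ?A] lookup_add distrib_right sum.distrib)
qed

lemma eval_at_mult [simp]: "eval_at v (f * g) = eval_at v f * eval_at v g"
proof (induction f rule: fpoly_additive_induct)
  case (2 m c)
  show ?case
  proof (induction g rule: fpoly_additive_induct)
    case (2 k d)
    show ?case
      by (simp add: mult_single lookup_add power_add prod.distrib)
  qed (simp_all add: distrib_left)
qed (simp_all add: distrib_right)

lemma eval_at_one [simp]: "eval_at v 1 = 1"
  by (simp flip: single_one)

lemma eval_at_power [simp]: "eval_at v (f ^ k) = eval_at v f ^ k"
  by (induction k) simp_all

lemma eval_at_prod [simp]: "eval_at v (\<Prod>i\<in>A. fs i) = (\<Prod>i\<in>A. eval_at v (fs i))"
  by (induction A rule: infinite_finite_induct) simp_all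

lemma fermat_little_mod_ring:
  fixes c :: "'p::prime_card mod_ring"
  assumes "c \<noteq> 0"
  shows "c ^ (CARD('p) - 1) = 1"
proof -
  have "c * c ^ (CARD('p) - 1) = c * 1"
    using fermat_mod_ring[of c] by (simp flip: power_Suc)
  with assms show ?thesis by (metis mult_left_cancel)
qed

lemma sum_powers_mod_ring_eq_0:
  assumes "k < CARD('p) - 1"
  shows "(\<Sum>x\<in>UNIV. (x :: 'p::prime_card mod_ring) ^ k) = 0"
proof (cases "k = 0")
  case True
  then show ?thesis by simp
next
  case False
  \<comment> \<open>The polynomial \<open>X^k - 1\<close> has too few roots to vanish on all units; a unit \<open>g\<close> where it does
    not vanish rescales the sum by \<open>g^k \<noteq> 1\<close>.\<close>
  let ?q = "Polynomial.monom 1 k - 1 :: 'p mod_ring poly"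
  have "Polynomial.degree ?q \<le> k"
    by (intro degree_diff_le) (auto simp: degree_monom_le)
  moreover have "?q \<noteq> 0"
  proof
    assume "?q = 0"
    then have "poly ?q 0 = 0" by simp
    with False show False by (simp add: poly_monom power_0_left)
  qed
  ultimately have "card {x. poly ?q x = 0} < CARD('p) - 1"
    using card_poly_roots_bound[of ?q] assms by linarith
  moreover have "card (UNIV - {0 :: 'p mod_ring}) = CARD('p) - 1"
    by simp
  ultimately have "\<not> UNIV - {0} \<subseteq> {x. poly ?q x = 0}"
    using card_mono[of "{x. poly ?q x = 0}" "UNIV - {0 :: 'p mod_ring}"] by auto
  then obtain g :: "'p mod_ring" where g: "g \<noteq> 0" "g ^ k \<noteq> 1"
    by (auto simp: poly_monom)
  have "bij ((*) g)"
    using g(1) by (intro bij_betwI[of _ _ _ "\<lambda>x. x / g"]) auto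
  then have "(\<Sum>x\<in>UNIV. x ^ k) = (\<Sum>x\<in>UNIV. (g * x) ^ k)"
    by (rule sum.reindex_bij_betw[symmetric])
  also have "\<dots> = g ^ k * (\<Sum>x\<in>UNIV. x ^ k)"
    by (simp add: power_mult_distrib sum_distrib_left)
  finally have "(1 - g ^ k) * (\<Sum>x\<in>UNIV. x ^ k) = 0" by (simp add: algebra_simps)
  with g(2) show ?thesis by simp
qed

lemma sum_top_powers_mod_ring:
  "(\<Sum>x\<in>UNIV. (x :: 'p::prime_card mod_ring) ^ (CARD('p) - 1)) = -1"
proof -
  have "CARD('p) > 1" using prime_card[where 'a='p] by (rule prime_gt_1_nat)
  then have "(x :: 'p mod_ring) ^ (CARD('p) - 1) = (if x = 0 then 0 else 1)" for x
    using fermat_little_mod_ring[of x] by (cases "x = 0") (simp_all add: zero_power)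
  then have "(\<Sum>x\<in>UNIV. (x :: 'p mod_ring) ^ (CARD('p) - 1)) = (\<Sum>x\<in>UNIV. if (x :: 'p mod_ring) = 0 then 0 else 1)"
    by (simp only:)
  also have "\<dots> = (\<Sum>x\<in>UNIV. 1 - (if (x :: 'p mod_ring) = 0 then 1 else 0))"
    by (intro sum.cong) auto
  also have "\<dots> = -1" by (simp add: sum_subtractf)
  finally show ?thesis .
qed

lemma sum_of_monomial_values:
  "(\<Sum>v\<in>UNIV. \<Prod>i\<in>UNIV. (v :: 'n::finite \<Rightarrow> 'p::prime_card mod_ring) i ^ Poly_Mapping.lookup m i)
    = (\<Prod>i\<in>UNIV. \<Sum>x\<in>UNIV. x ^ Poly_Mapping.lookup m i)"
proof -
  have "PiE UNIV (\<lambda>_. UNIV) = (UNIV :: ('n \<Rightarrow> 'p mod_ring) set)" by auto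
  then show ?thesis
    using prod_sum_PiE[of "UNIV :: 'n set" "\<lambda>_. UNIV :: 'p mod_ring set"
        "\<lambda>i x. x ^ Poly_Mapping.lookup m i"]
    by simp
qed

text \<open>
  An exponent vector of degree at most \<open>n (p - 1)\<close> other than the constant one \<open>p - 1\<close> has an entry
  below \<open>p - 1\<close>, and the power sum for this entry vanishes.
\<close>

lemma sum_of_low_degree_monomial_values:
  fixes m :: "'n::finite \<Rightarrow>\<^sub>0 nat"
  assumes "exp_degree m \<le> CARD('n) * (CARD('p) - 1)"
  shows "(\<Sum>v\<in>UNIV. \<Prod>i\<in>UNIV. (v :: 'n \<Rightarrow> 'p::prime_card mod_ring) i ^ Poly_Mapping.lookup m i)
    = (if m = trace_exp CARD('p) 0 then (-1) ^ CARD('n) else 0)"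
proof (cases "\<exists>i. Poly_Mapping.lookup m i < CARD('p) - 1")
  case True
  then obtain i where i: "Poly_Mapping.lookup m i < CARD('p) - 1" ..
  then have "m \<noteq> trace_exp CARD('p) 0" by (auto simp: trace_exp_def lookup_add)
  moreover have "(\<Prod>i\<in>UNIV. \<Sum>x\<in>UNIV. (x :: 'p mod_ring) ^ Poly_Mapping.lookup m i) = 0"
    using sum_powers_mod_ring_eq_0[OF i] by (intro prod_zero) auto
  ultimately show ?thesis by (simp add: sum_of_monomial_values)
next
  case False
  then have le: "CARD('p) - 1 \<le> Poly_Mapping.lookup m i" for i by (simp add: not_less)
  have "Poly_Mapping.lookup m i = CARD('p) - 1" for i
  proof (rule ccontr)
    assume "Poly_Mapping.lookup m i \<noteq> CARD('p) - 1"
    then have "(\<Sum>i\<in>(UNIV :: 'n set). CARD('p) - 1) < exp_degree m"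
      unfolding exp_degree_def using le
      by (intro sum_strict_mono_ex1) (auto intro!: exI[of _ i] simp: order.strict_iff_order)
    with assms show False by simp
  qed
  then have lookup_m: "Poly_Mapping.lookup m = (\<lambda>i. CARD('p) - 1)" by auto
  then have "m = trace_exp CARD('p) 0"
    by (intro poly_mapping_eqI) (simp add: trace_exp_def lookup_add)
  moreover have "(\<Prod>i\<in>UNIV. \<Sum>x\<in>UNIV. (x :: 'p mod_ring) ^ Poly_Mapping.lookup m i) = (-1) ^ CARD('n)"
    by (simp only: lookup_m sum_top_powers_mod_ring prod_constant)
  ultimately show ?thesis
    by (simp add: sum_of_monomial_values)
qed

lemma sum_of_values_eq_trace:
  fixes g :: "('n::finite, 'p::prime_card) fpoly"
  assumes "total_degree g \<le> CARD('n) * (CARD('p) - 1)"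
  shows "(\<Sum>v\<in>UNIV. eval_at v g) = (-1) ^ CARD('n) * Poly_Mapping.lookup (Tr g) 0"
proof -
  let ?t = "trace_exp CARD('p) (0 :: 'n \<Rightarrow>\<^sub>0 nat)"
  have "(\<Sum>v\<in>UNIV. eval_at v g) = (\<Sum>m\<in>Poly_Mapping.keys g. Poly_Mapping.lookup g m *
      (\<Sum>v\<in>UNIV. \<Prod>i\<in>UNIV. (v :: 'n \<Rightarrow> 'p mod_ring) i ^ Poly_Mapping.lookup m i))"
    unfolding eval_at_def by (subst sum.swap) (simp add: sum_distrib_left)
  also have "\<dots> = (\<Sum>m\<in>Poly_Mapping.keys g. if m = ?t then Poly_Mapping.lookup g m * (-1) ^ CARD('n) else 0)"
  proof (intro sum.cong refl)
    fix m assume "m \<in> Poly_Mapping.keys g"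
    then have "exp_degree m \<le> CARD('n) * (CARD('p) - 1)"
      using assms by (simp add: total_degree_le_iff in_keys_iff)
    then show "Poly_Mapping.lookup g m *
        (\<Sum>v\<in>UNIV. \<Prod>i\<in>UNIV. (v :: 'n \<Rightarrow> 'p mod_ring) i ^ Poly_Mapping.lookup m i)
      = (if m = ?t then Poly_Mapping.lookup g m * (-1) ^ CARD('n) else 0)"
      by (simp add: sum_of_low_degree_monomial_values)
  qed
  also have "\<dots> = (-1) ^ CARD('n) * Poly_Mapping.lookup (Tr g) 0"
    by (simp add: Tr_eq_trace_map lookup_trace_map in_keys_iff)
  finally show ?thesis .
qed


section \<open>Counting zeros\<close>

lemma total_degree_power_p_minus_1:
  fixes f :: "('n::finite, 'p::prime_card) fpoly"
  assumes "total_degree f \<le> d"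
  shows "total_degree (f ^ (CARD('p) - 1)) \<le> d * (CARD('p) - 1)"
  using total_degree_power_le[of f "CARD('p) - 1"] assms
  by (metis mult.commute mult_le_mono1 order_trans)

text \<open>
  The coefficient of \<open>x^k\<close> in the trace comes from a monomial of degree \<open>p |k| + n (p - 1)\<close>, which
  exceeds the degree of \<open>f^(p-1)\<close> unless \<open>k = 0\<close>.
\<close>

lemma Tr_eq_Const:
  fixes f :: "('n::finite, 'p::prime_card) fpoly"
  assumes "total_degree f \<le> CARD('n)"
  shows "Tr (f ^ (CARD('p) - 1)) = Const (Poly_Mapping.lookup (Tr (f ^ (CARD('p) - 1))) 0)"
proof (rule poly_mapping_eqI)
  fix k
  have "Poly_Mapping.lookup (Tr (f ^ (CARD('p) - 1))) k = 0" if "k \<noteq> 0"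
  proof (rule ccontr)
    assume "Poly_Mapping.lookup (Tr (f ^ (CARD('p) - 1))) k \<noteq> 0"
    then have "exp_degree (trace_exp CARD('p) k) \<le> CARD('n) * (CARD('p) - 1)"
      using total_degree_power_p_minus_1[OF assms]
      by (simp add: Tr_eq_trace_map lookup_trace_map total_degree_le_iff)
    then show False
      using that by (simp add: exp_degree_trace_exp exp_degree_eq_0_iff)
  qed
  then show "Poly_Mapping.lookup (Tr (f ^ (CARD('p) - 1))) k
      = Poly_Mapping.lookup (Const (Poly_Mapping.lookup (Tr (f ^ (CARD('p) - 1))) 0)) k"
    by (cases "k = 0") (auto simp: Const_def lookup_single when_def)
qed

text \<open>The monomial with all exponents \<open>p - 1\<close> is out of reach for \<open>f^(p-1)\<close>.\<close>

lemma lookup_Tr_eq_0_of_small_degree: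
  fixes f :: "('n::finite, 'p::prime_card) fpoly"
  assumes "total_degree f < CARD('n)"
  shows "Poly_Mapping.lookup (Tr (f ^ (CARD('p) - 1))) 0 = 0"
proof (rule ccontr)
  assume "Poly_Mapping.lookup (Tr (f ^ (CARD('p) - 1))) 0 \<noteq> 0"
  then have "exp_degree (trace_exp CARD('p) (0 :: 'n \<Rightarrow>\<^sub>0 nat)) \<le> total_degree f * (CARD('p) - 1)"
    using total_degree_power_p_minus_1[OF order_refl, of f]
    by (simp add: Tr_eq_trace_map lookup_trace_map total_degree_le_iff)
  then have "CARD('n) * (CARD('p) - 1) \<le> total_degree f * (CARD('p) - 1)"
    by (simp add: exp_degree_trace_exp)
  moreover have "CARD('p) - 1 > 0"
    using prime_gt_1_nat[OF prime_card[where 'a='p]] by simp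
  ultimately show False using assms by simp
qed

text \<open>
  The indicator function of the common zeros is \<open>\<Prod>(1 - f\<^sub>i^(p-1))\<close>. Expanding it, the subset \<open>S\<close>
  of factors contributes a sum of values of \<open>(\<Prod>i\<in>S. f\<^sub>i)^(p-1)\<close>, and only the full product has
  degree large enough for this sum to be nonzero.
\<close>

lemma card_common_zeros:
  fixes fs :: "'i \<Rightarrow> ('n::finite, 'p::prime_card) fpoly"
  assumes "finite A" and deg: "total_degree (\<Prod>i\<in>A. fs i) \<le> CARD('n)"
    and deg_less: "\<And>S. S \<subset> A \<Longrightarrow> total_degree (\<Prod>i\<in>S. fs i) < CARD('n)"
  shows "of_nat (card {v. \<forall>i\<in>A. eval_at v (fs i) = 0})
    = (-1) ^ (CARD('n) + card A) * Poly_Mapping.lookup (Tr ((\<Prod>i\<in>A. fs i) ^ (CARD('p) - 1))) 0"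
proof -
  let ?r = "CARD('p) - 1"
  let ?P = "\<lambda>S. \<Prod>i\<in>S. fs i"
  have r: "?r > 0" using prime_gt_1_nat[OF prime_card[where 'a='p]] by simp
  have indicator: "(\<Prod>i\<in>A. - (eval_at v (fs i) ^ ?r) + 1) = (if \<forall>i\<in>A. eval_at v (fs i) = 0 then 1 else 0)" for v
  proof (cases "\<forall>i\<in>A. eval_at v (fs i) = 0")
    case True
    then show ?thesis using r by (simp add: zero_power)
  next
    case False
    then have "\<exists>i\<in>A. - (eval_at v (fs i) ^ ?r) + 1 = 0"
      using fermat_little_mod_ring by fastforce
    with False \<open>finite A\<close> show ?thesis by (simp add: prod_zero)
  qed
  have sum_values: "(\<Sum>v\<in>UNIV. eval_at v (?P S ^ ?r)) = (-1) ^ CARD('n) * Poly_Mapping.lookup (Tr (?P S ^ ?r)) 0"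
    if "S \<subseteq> A" for S
  proof (intro sum_of_values_eq_trace total_degree_power_p_minus_1)
    show "total_degree (?P S) \<le> CARD('n)"
      using that deg deg_less[of S] by (cases "S = A") (simp_all add: psubset_eq)
  qed
  have "of_nat (card {v. \<forall>i\<in>A. eval_at v (fs i) = 0})
      = (\<Sum>v\<in>UNIV. if \<forall>i\<in>A. eval_at v (fs i) = 0 then 1 else 0 :: 'p mod_ring)"
    by (simp add: sum.If_cases)
  also have "\<dots> = (\<Sum>v\<in>UNIV. \<Prod>i\<in>A. - (eval_at v (fs i) ^ ?r) + 1)"
    by (simp only: indicator)
  also have "\<dots> = (\<Sum>v\<in>UNIV. \<Sum>S\<in>Pow A. (-1) ^ card S * eval_at v (?P S ^ ?r))"
    by (simp only: prod_add[OF \<open>finite A\<close>] prod_uminus eval_at_power eval_at_prod prod_power_distrib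
        prod.neutral_const mult_1_right)
  also have "\<dots> = (\<Sum>S\<in>Pow A. (-1) ^ card S * (\<Sum>v\<in>UNIV. eval_at v (?P S ^ ?r)))"
    by (subst sum.swap) (simp only: sum_distrib_left)
  also have "\<dots> = (\<Sum>S\<in>Pow A. if S = A then (-1) ^ (CARD('n) + card A) * Poly_Mapping.lookup (Tr (?P A ^ ?r)) 0 else 0)"
  proof (intro sum.cong refl)
    fix S assume S: "S \<in> Pow A"
    show "(-1) ^ card S * (\<Sum>v\<in>UNIV. eval_at v (?P S ^ ?r))
      = (if S = A then (-1) ^ (CARD('n) + card A) * Poly_Mapping.lookup (Tr (?P A ^ ?r)) 0 else 0)"
    proof (cases "S = A")
      case True
      then show ?thesis
        using sum_values[OF order_refl] by (simp add: power_add)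
    next
      case False
      then have "Poly_Mapping.lookup (Tr (?P S ^ ?r)) 0 = 0"
        using S by (intro lookup_Tr_eq_0_of_small_degree deg_less) auto
      moreover have "(\<Sum>v\<in>UNIV. eval_at v (?P S ^ ?r)) = (-1) ^ CARD('n) * Poly_Mapping.lookup (Tr (?P S ^ ?r)) 0"
        using S by (intro sum_values) simp
      ultimately show ?thesis using False by (simp only: mult_zero_right if_False)
    qed
  qed
  also have "\<dots> = (-1) ^ (CARD('n) + card A) * Poly_Mapping.lookup (Tr (?P A ^ ?r)) 0"
    using \<open>finite A\<close> by simp
  finally show ?thesis .
qed


section \<open>Ideals and minimal primes\<close>

lemma ring_of_type_simps [simp]:
  "carrier (ring_of_type :: 'a::comm_ring_1 ring) = UNIV"
  "x \<otimes>\<^bsub>ring_of_type\<^esub> y = x * (y :: 'a)"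
  "x \<oplus>\<^bsub>ring_of_type\<^esub> y = x + (y :: 'a)"
  "\<one>\<^bsub>ring_of_type\<^esub> = (1 :: 'a)"
  "\<zero>\<^bsub>ring_of_type\<^esub> = (0 :: 'a)"
  by (simp_all add: ring_of_type_def)

interpretation ring_of_type: cring "ring_of_type :: 'a::comm_ring_1 ring"
  by (rule cring_ring_of_type)

lemma ideal_ring_of_type_iff:
  fixes I :: "'a::comm_ring_1 set"
  shows "ideal I ring_of_type \<longleftrightarrow> 0 \<in> I \<and> (\<forall>a\<in>I. \<forall>b\<in>I. a + b \<in> I) \<and> (\<forall>a\<in>I. \<forall>r. r * a \<in> I)"
proof
  assume "ideal I ring_of_type"
  then interpret ideal I ring_of_type .
  show "0 \<in> I \<and> (\<forall>a\<in>I. \<forall>b\<in>I. a + b \<in> I) \<and> (\<forall>a\<in>I. \<forall>r. r * a \<in> I)"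
    using zero_closed a_closed I_l_closed by auto
next
  assume I: "0 \<in> I \<and> (\<forall>a\<in>I. \<forall>b\<in>I. a + b \<in> I) \<and> (\<forall>a\<in>I. \<forall>r. r * a \<in> I)"
  have minus: "\<ominus>\<^bsub>ring_of_type\<^esub> a = -1 * a" for a :: 'a
    by (rule ring_of_type.minus_equality) auto
  show "ideal I ring_of_type"
  proof (rule idealI)
    show "subgroup I (add_monoid ring_of_type)"
    proof
      fix a assume "a \<in> I"
      then show "inv\<^bsub>add_monoid ring_of_type\<^esub> a \<in> I"
        using I minus[of a] unfolding a_inv_def by metis
    qed (use I in auto)
  qed (use I in \<open>auto simp: mult.commute ring_of_type.ring_axioms\<close>)
qed

lemma primeideal_ring_of_type_iff:
  fixes P :: "'a::comm_ring_1 set"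
  shows "primeideal P ring_of_type \<longleftrightarrow>
    ideal P ring_of_type \<and> 1 \<notin> P \<and> (\<forall>a b. a * b \<in> P \<longrightarrow> a \<in> P \<or> b \<in> P)"
proof
  assume "primeideal P ring_of_type"
  then interpret primeideal P ring_of_type .
  show "ideal P ring_of_type \<and> 1 \<notin> P \<and> (\<forall>a b. a * b \<in> P \<longrightarrow> a \<in> P \<or> b \<in> P)"
    using is_ideal one_imp_carrier I_notcarr I_prime by auto
next
  assume "ideal P ring_of_type \<and> 1 \<notin> P \<and> (\<forall>a b. a * b \<in> P \<longrightarrow> a \<in> P \<or> b \<in> P)"
  then show "primeideal P ring_of_type"
    by (intro primeidealI cring_ring_of_type) auto
qed

lemma principal_ideal_of_eq: "principal_ideal_of f = {r * f | r. True}"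
proof -
  have "principal_ideal_of f = cgenideal ring_of_type f"
    unfolding principal_ideal_of_def
    by (rule ring_of_type.cgenideal_eq_genideal[symmetric]) simp
  then show ?thesis by (simp add: cgenideal_def)
qed

text \<open>
  By Zorn's lemma there is an ideal maximal among those that avoid the multiplicative set, and it is
  prime: adjoining an element outside it meets the set, and so the product of two such elements
  cannot lie in the ideal.
\<close>

lemma ex_prime_avoiding_multiplicative_set:
  fixes I S :: "'a::comm_ring_1 set"
  assumes "ideal I ring_of_type" "I \<inter> S = {}"
    and "1 \<in> S" and S_mult: "\<And>s t. s \<in> S \<Longrightarrow> t \<in> S \<Longrightarrow> s * t \<in> S"
  shows "\<exists>Q. primeideal Q ring_of_type \<and> I \<subseteq> Q \<and> Q \<inter> S = {}"
proof -
  define \<A> where "\<A> = {J. ideal J ring_of_type \<and> I \<subseteq> J \<and> J \<inter> S = {}}"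
  have "\<exists>M\<in>\<A>. \<forall>X\<in>\<A>. M \<subseteq> X \<longrightarrow> X = M"
  proof (rule subset_Zorn_nonempty)
    show "\<A> \<noteq> {}" using assms by (auto simp: \<A>_def)
    fix \<C> assume \<C>: "\<C> \<noteq> {}" "subset.chain \<A> \<C>"
    have "a + b \<in> \<Union>\<C>" if ab: "a \<in> \<Union>\<C>" "b \<in> \<Union>\<C>" for a b
    proof -
      obtain J K where "J \<in> \<C>" "K \<in> \<C>" "a \<in> J" "b \<in> K" using ab by blast
      moreover from this \<C>(2) have "J \<subseteq> K \<or> K \<subseteq> J"
        by (auto simp: subset_chain_def)
      ultimately obtain L where "L \<in> \<C>" "a \<in> L" "b \<in> L" by blast
      moreover from this \<C>(2) have "ideal L ring_of_type"
        by (auto simp: subset_chain_def \<A>_def)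
      ultimately show ?thesis by (auto simp: ideal_ring_of_type_iff)
    qed
    moreover have members: "ideal J ring_of_type" "I \<subseteq> J" "J \<inter> S = {}" if "J \<in> \<C>" for J
      using \<C>(2) that by (auto simp: subset_chain_def \<A>_def)
    moreover obtain J\<^sub>0 where "J\<^sub>0 \<in> \<C>" using \<C>(1) by blast
    moreover from this have "0 \<in> \<Union>\<C>" "I \<subseteq> \<Union>\<C>"
      using members(1,2)[of J\<^sub>0] by (auto simp: ideal_ring_of_type_iff)
    moreover have "r * a \<in> \<Union>\<C>" if "a \<in> \<Union>\<C>" for a r
      using members(1) that unfolding ideal_ring_of_type_iff by blast
    moreover have "\<Union>\<C> \<inter> S = {}" using members(3) by blast
    ultimately show "\<Union>\<C> \<in> \<A>"
      unfolding \<A>_def ideal_ring_of_type_iff by blast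
  qed
  then obtain M where M: "ideal M ring_of_type" "I \<subseteq> M" "M \<inter> S = {}"
    and max: "\<And>X. ideal X ring_of_type \<Longrightarrow> I \<subseteq> X \<Longrightarrow> X \<inter> S = {} \<Longrightarrow> M \<subseteq> X \<Longrightarrow> X = M"
    by (auto simp: \<A>_def)
  have M0: "0 \<in> M" and M_add: "\<And>a b. a \<in> M \<Longrightarrow> b \<in> M \<Longrightarrow> a + b \<in> M"
    and M_mult: "\<And>a r. a \<in> M \<Longrightarrow> r * a \<in> M"
    using M(1) by (auto simp: ideal_ring_of_type_iff)
  have meets: "\<exists>m r. m \<in> M \<and> m + r * a \<in> S" if "a \<notin> M" for a
  proof (rule ccontr)
    assume no: "\<nexists>m r. m \<in> M \<and> m + r * a \<in> S"
    let ?X = "{m + r * a | m r. m \<in> M}"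
    have "ideal ?X ring_of_type"
      unfolding ideal_ring_of_type_iff
    proof (intro conjI ballI allI)
      show "0 \<in> ?X" using M0 by (auto intro!: exI[of _ 0])
    next
      fix x y assume "x \<in> ?X" "y \<in> ?X"
      then obtain m r m' r' where "x = m + r * a" "y = m' + r' * a" "m \<in> M" "m' \<in> M" by blast
      moreover have "(m + r * a) + (m' + r' * a) = (m + m') + (r + r') * a"
        by (simp add: algebra_simps)
      ultimately show "x + y \<in> ?X" using M_add[of m m'] by blast
    next
      fix x t assume "x \<in> ?X"
      then obtain m r where "x = m + r * a" "m \<in> M" by blast
      moreover have "t * (m + r * a) = t * m + (t * r) * a"
        by (simp add: algebra_simps)
      ultimately show "t * x \<in> ?X" using M_mult[of m t] by blast
    qed
    moreover have "M \<subseteq> ?X" by (force intro: exI[of _ 0])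
    moreover have "0 + 1 * a \<in> ?X" using M0 by blast
    then have "a \<in> ?X" by simp
    ultimately show False using max[of ?X] M(2) no that by blast
  qed
  have "a \<in> M \<or> b \<in> M" if ab: "a * b \<in> M" for a b
  proof (rule ccontr)
    assume "\<not> (a \<in> M \<or> b \<in> M)"
    then obtain m r m' r' where m: "m \<in> M" "m' \<in> M" and "m + r * a \<in> S" "m' + r' * b \<in> S"
      using meets by meson
    then have "(m + r * a) * (m' + r' * b) \<in> S" by (intro S_mult)
    moreover have "(m + r * a) * (m' + r' * b) = (m' + r' * b) * m + (r * a) * m' + (r * r') * (a * b)"
      by (simp add: algebra_simps)
    ultimately show False
      using M(3) m ab M_add M_mult by (metis disjoint_iff)
  qed
  moreover have "1 \<notin> M" using M(3) assms(3) by blast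
  ultimately show ?thesis using M by (auto simp: primeideal_ring_of_type_iff)
qed

text \<open>
  Localizing at a minimal prime makes it the nilradical modulo \<open>I\<close>. In elementary terms: otherwise
  the products \<open>s a^k\<close> with \<open>s \<notin> P\<close> form a multiplicative set avoiding \<open>I\<close>, and a prime over \<open>I\<close>
  avoiding it lies in \<open>P\<close> but misses \<open>a\<close>.
\<close>

lemma minimal_prime_locally_nilpotent:
  fixes I P :: "'a::comm_ring_1 set"
  assumes "ideal I ring_of_type" "minimal_prime_over I P" "a \<in> P"
  shows "\<exists>s k. s \<notin> P \<and> s * a ^ k \<in> I"
proof (rule ccontr)
  assume no: "\<nexists>s k. s \<notin> P \<and> s * a ^ k \<in> I"
  define S where "S = {s * a ^ k | s k. s \<notin> P}"
  have P: "primeideal P ring_of_type" "I \<subseteq> P"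
    and minimal: "\<And>Q. primeideal Q ring_of_type \<Longrightarrow> I \<subseteq> Q \<Longrightarrow> Q \<subseteq> P \<Longrightarrow> Q = P"
    using assms(2) by (auto simp: minimal_prime_over_def)
  then have P1: "1 \<notin> P" and P_mult: "\<And>a b. a * b \<in> P \<Longrightarrow> a \<in> P \<or> b \<in> P"
    by (auto simp: primeideal_ring_of_type_iff)
  have in_S: "s * a ^ k \<in> S" if "s \<notin> P" for s k using that by (auto simp: S_def)
  have "\<exists>Q. primeideal Q ring_of_type \<and> I \<subseteq> Q \<and> Q \<inter> S = {}"
  proof (rule ex_prime_avoiding_multiplicative_set[OF assms(1)])
    show "I \<inter> S = {}" using no by (auto simp: S_def)
    show "1 \<in> S" using in_S[OF P1, of 0] by simp
    fix s t assume "s \<in> S" "t \<in> S"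
    then obtain x j y k where *: "s = x * a ^ j" "t = y * a ^ k" "x \<notin> P" "y \<notin> P"
      by (auto simp: S_def)
    then have "x * y * a ^ (j + k) \<in> S" using P_mult by (intro in_S) blast
    then show "s * t \<in> S" using * by (simp add: power_add mult_ac)
  qed
  then obtain Q where Q: "primeideal Q ring_of_type" "I \<subseteq> Q" "Q \<inter> S = {}" by blast
  have "Q \<subseteq> P" using Q(3) in_S[of _ 0] by auto
  moreover have "a \<notin> Q" using Q(3) in_S[OF P1, of 1] by auto
  ultimately show False using minimal[OF Q(1,2)] assms(3) by blast
qed


section \<open>Compatibly split ideals\<close>

lemma splitting_root:
  assumes "splitting p \<phi>"
  shows "\<phi> (a ^ p) = a"
  using assms unfolding splitting_def near_splitting_def by (metis mult.right_neutral)

text \<open>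
  A splitting extracts \<open>p\<close>-th roots inside \<open>I\<close>. This lowers any exponent \<open>k + 1 \<ge> 2\<close>, since
  \<open>k + 1 \<le> k p\<close> puts \<open>(a^k)^p\<close> into \<open>I\<close>.
\<close>

lemma compatibly_split_imp_radical:
  assumes "splitting p \<phi>" "p \<ge> 2" "compatibly_split \<phi> I"
  shows "radical_ideal I"
  unfolding radical_ideal_def
proof (intro conjI allI impI)
  show I: "ideal I ring_of_type" using assms(3) by (simp add: compatibly_split_def)
  then have I_mult: "\<And>x r. x \<in> I \<Longrightarrow> r * x \<in> I" by (simp add: ideal_ring_of_type_iff)
  have root: "a \<in> I" if "a ^ p \<in> I" for a
  proof -
    have "\<phi> (a ^ p) \<in> I" using assms(3) that by (auto simp: compatibly_split_def)
    then show ?thesis by (simp add: splitting_root[OF assms(1)])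
  qed
  fix a k assume "a ^ k \<in> I"
  then show "a \<in> I"
  proof (induction k)
    case 0
    then show ?case using I_mult[of 1 a] by simp
  next
    case (Suc k)
    show ?case
    proof (cases "k = 0")
      case True
      with Suc.prems show ?thesis by simp
    next
      case False
      then have "Suc k \<le> k * 2" by simp
      also have "\<dots> \<le> k * p" using assms(2) by (rule mult_le_mono2)
      finally have "Suc k \<le> k * p" .
      then have eq: "(a ^ k) ^ p = a ^ (k * p - Suc k) * a ^ Suc k"
        by (simp only: power_mult[symmetric] power_add[symmetric] le_add_diff_inverse2)
      have "(a ^ k) ^ p \<in> I" unfolding eq by (rule I_mult[OF Suc.prems])
      then show ?thesis by (rule Suc.IH[OF root])
    qed
  qed
qed

lemma compatibly_split_sum:
  assumes "splitting p \<phi>" "compatibly_split \<phi> I" "compatibly_split \<phi> J"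
  shows "compatibly_split \<phi> (I <+>\<^bsub>ring_of_type\<^esub> J)"
proof -
  have add: "\<phi> (a + b) = \<phi> a + \<phi> b" for a b
    using assms(1) by (simp add: splitting_def near_splitting_def)
  have sum: "I <+>\<^bsub>ring_of_type\<^esub> J = {a + b | a b. a \<in> I \<and> b \<in> J}"
    by (auto simp: set_add_def')
  show ?thesis
    unfolding compatibly_split_def
  proof (intro conjI subsetI)
    show "ideal (I <+>\<^bsub>ring_of_type\<^esub> J) ring_of_type"
      using assms(2,3) by (intro ring_of_type.add_ideals) (simp_all add: compatibly_split_def)
    fix y assume "y \<in> \<phi> ` (I <+>\<^bsub>ring_of_type\<^esub> J)"
    then obtain a b where ab: "a \<in> I" "b \<in> J" "y = \<phi> (a + b)" unfolding sum by blast
    then have "\<phi> a \<in> I" "\<phi> b \<in> J" using assms(2,3) by (auto simp: compatibly_split_def)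
    then show "y \<in> I <+>\<^bsub>ring_of_type\<^esub> J" unfolding sum ab(3) add by blast
  qed
qed

lemma compatibly_split_inter:
  "compatibly_split \<phi> I \<Longrightarrow> compatibly_split \<phi> J \<Longrightarrow> compatibly_split \<phi> (I \<inter> J)"
  by (auto simp: compatibly_split_def ideal_ring_of_type_iff)

text \<open>
  For \<open>a \<in> P\<close> some \<open>s \<notin> P\<close> has \<open>s a \<in> I\<close>, because \<open>I\<close> is radical. Then \<open>s \<phi>(a) = \<phi>(s^p a)\<close> lies in
  \<open>I \<subseteq> P\<close>, and cancelling \<open>s\<close> puts \<open>\<phi>(a)\<close> in \<open>P\<close>.
\<close>

lemma compatibly_split_minimal_prime:
  assumes \<phi>: "splitting p \<phi>" and "p \<ge> 2" and I: "compatibly_split \<phi> I"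
    and P: "minimal_prime_over I P"
  shows "compatibly_split \<phi> P"
  unfolding compatibly_split_def
proof (intro conjI subsetI)
  have I_ideal: "ideal I ring_of_type" using I by (simp add: compatibly_split_def)
  have prime: "primeideal P ring_of_type" and "I \<subseteq> P"
    using P by (auto simp: minimal_prime_over_def)
  then show "ideal P ring_of_type" by (simp add: primeideal_ring_of_type_iff)
  fix y assume "y \<in> \<phi> ` P"
  then obtain a where a: "a \<in> P" and y: "y = \<phi> a" by blast
  obtain s k where s: "s \<notin> P" "s * a ^ k \<in> I"
    using minimal_prime_locally_nilpotent[OF I_ideal P a] by blast
  have "(s * a) ^ Suc k = (s ^ k * a) * (s * a ^ k)"
    by (simp add: power_mult_distrib mult_ac)
  also have "\<dots> \<in> I" using I_ideal s(2) by (simp add: ideal_ring_of_type_iff)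
  finally have "s * a \<in> I"
    using compatibly_split_imp_radical[OF \<phi> \<open>p \<ge> 2\<close> I] unfolding radical_ideal_def by blast
  then have "s ^ (p - 1) * (s * a) \<in> I" using I_ideal by (simp add: ideal_ring_of_type_iff)
  moreover have "s ^ (p - 1) * (s * a) = s ^ p * a"
    using \<open>p \<ge> 2\<close> by (simp add: power_eq_if mult_ac)
  ultimately have "\<phi> (s ^ p * a) \<in> I" using I by (auto simp: compatibly_split_def)
  then have "s * \<phi> a \<in> P"
    using \<phi> \<open>I \<subseteq> P\<close> by (auto simp: splitting_def near_splitting_def)
  with s(1) prime show "y \<in> P" by (auto simp: y primeideal_ring_of_type_iff)
qed

lemma constructible_compatibly_split:
  assumes "splitting p \<phi>" "p \<ge> 2" "compatibly_split \<phi> I\<^sub>0" "constructible I\<^sub>0 I"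
  shows "compatibly_split \<phi> I"
  using assms(4)
  by induction
     (use assms in \<open>auto intro: compatibly_split_minimal_prime compatibly_split_sum compatibly_split_inter\<close>)

lemma splitting_of_nonzero_trace:
  fixes f :: "('n::finite, 'p::prime_card) fpoly"
  assumes "Tr (f ^ (CARD('p) - 1)) = Const t" "t \<noteq> 0"
  defines "\<phi> \<equiv> \<lambda>g. Const (inverse t) * Tr (f ^ (CARD('p) - 1) * g)"
  shows "splitting CARD('p) \<phi>" and "compatibly_split \<phi> (principal_ideal_of f)"
proof -
  have add: "Tr (a + b) = Tr a + Tr b" and root: "Tr (a ^ CARD('p) * b) = a * Tr b"
    for a b :: "('n, 'p) fpoly"
    using near_splitting_trace_map[where 'n='n and 'p='p]
    by (auto simp: Tr_eq_trace_map near_splitting_def)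
  have "Const (inverse t) * Const t = (1 :: ('n, 'p) fpoly)"
    using assms(2) by (simp add: Const_def mult_single)
  then have "\<phi> 1 = 1" by (simp only: \<phi>_def mult_1_right assms(1))
  moreover have linear: "\<phi> (a ^ CARD('p) * b) = a * \<phi> b" for a b
  proof -
    have "f ^ (CARD('p) - 1) * (a ^ CARD('p) * b) = a ^ CARD('p) * (f ^ (CARD('p) - 1) * b)"
      by (simp add: mult_ac)
    then have "\<phi> (a ^ CARD('p) * b) = Const (inverse t) * (a * Tr (f ^ (CARD('p) - 1) * b))"
      by (simp only: \<phi>_def root)
    then show ?thesis by (simp only: \<phi>_def mult.left_commute)
  qed
  moreover have "\<phi> (a + b) = \<phi> a + \<phi> b" for a b
    by (simp add: \<phi>_def distrib_left add)
  ultimately show "splitting CARD('p) \<phi>"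
    by (simp add: splitting_def near_splitting_def)
  have "\<phi> (r * f) = (Const (inverse t) * Tr r) * f" for r
  proof -
    have "f ^ (CARD('p) - 1) * (r * f) = f ^ CARD('p) * r"
      by (simp add: power_eq_if mult_ac)
    then have "\<phi> (r * f) = Const (inverse t) * (f * Tr r)"
      by (simp only: \<phi>_def root)
    then show ?thesis by (simp only: mult_ac)
  qed
  moreover have "ideal (principal_ideal_of f) ring_of_type"
    unfolding principal_ideal_of_def by (rule ring_of_type.genideal_ideal) simp
  ultimately show "compatibly_split \<phi> (principal_ideal_of f)"
    by (auto simp: compatibly_split_def principal_ideal_of_eq)
qed


section \<open>Point counts, splittings and radical ideals\<close>

lemma Const_sign: "Const ((-1) ^ k * t) = (-1) ^ k * (Const t :: ('n::finite, 'p::prime_card) fpoly)"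
  by (cases "even k") (simp_all add: Const_def single_uminus)

lemma subproduct_degree_less:
  fixes fs :: "'i \<Rightarrow> ('n::finite, 'p::prime_card) fpoly"
  assumes "finite A" "\<And>i. i \<in> A \<Longrightarrow> total_degree (fs i) > 0" "S \<subset> A"
  shows "total_degree (\<Prod>i\<in>S. fs i) < total_degree (\<Prod>i\<in>A. fs i)"
proof -
  have nonzero: "fs i \<noteq> 0" if "i \<in> A" for i using assms(2)[OF that] by auto
  have "finite S" "S \<subseteq> A" using assms(1,3) finite_subset by auto
  moreover obtain i where "i \<in> A - S" using assms(3) by blast
  ultimately have "(\<Sum>i\<in>S. total_degree (fs i)) < (\<Sum>i\<in>A. total_degree (fs i))"
    using assms by (intro sum_strict_mono2[of A S i]) auto
  moreover have "total_degree (\<Prod>i\<in>S. fs i) = (\<Sum>i\<in>S. total_degree (fs i))"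
    using \<open>finite S\<close> \<open>S \<subseteq> A\<close> nonzero by (intro conjunct1[OF total_degree_prod]) auto
  ultimately show ?thesis
    using total_degree_prod[OF assms(1), of fs] nonzero by simp
qed

lemma card_le_total_degree_prod:
  fixes fs :: "'i \<Rightarrow> ('n::finite, 'p::prime_card) fpoly"
  assumes "finite A" "\<And>i. i \<in> A \<Longrightarrow> total_degree (fs i) > 0"
  shows "card A \<le> total_degree (\<Prod>i\<in>A. fs i)"
proof -
  have "fs i \<noteq> 0" if "i \<in> A" for i using assms(2)[OF that] by auto
  then have "total_degree (\<Prod>i\<in>A. fs i) = (\<Sum>i\<in>A. total_degree (fs i))"
    using assms(1) by (intro conjunct1[OF total_degree_prod]) auto
  moreover have "card A * 1 \<le> (\<Sum>i\<in>A. total_degree (fs i))"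
    using sum_mono[of A "\<lambda>_. 1" "\<lambda>i. total_degree (fs i)"] assms(2) by (simp add: Suc_leI)
  ultimately show ?thesis by simp
qed

theorem theorem1:
  fixes f :: "('n::finite, 'p::prime_card) fpoly"
    and n p :: nat
  assumes "n = CARD('n)" and "p = CARD('p)"
    and "total_degree f \<le> n"
  shows "(Const (of_nat (card {v. eval_at v f = 0})) = (-1) ^ (n - 1) * Tr (f ^ (p - 1)))
    \<and> (\<not> p dvd card {v. eval_at v f = 0} \<longrightarrow>
         (\<exists>c. splitting p (\<lambda>g. Const c * Tr (f ^ (p - 1) * g)) \<and>
              compatibly_split (\<lambda>g. Const c * Tr (f ^ (p - 1) * g)) (principal_ideal_of f)) \<and>
         total_degree f = n)
    \<and> (\<forall>(m::nat) fs. f = (\<Prod>i\<in>{1..m}. fs i) \<and> (\<forall>i\<in>{1..m}. total_degree (fs i) > 0) \<longrightarrow>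
         Const (of_nat (card {v. \<forall>i\<in>{1..m}. eval_at v (fs i) = 0})) =
           (-1) ^ (n - m) * Tr (f ^ (p - 1)))
    \<and> (\<not> p dvd card {v. eval_at v f = 0} \<or>
       (\<exists>(m::nat) fs. f = (\<Prod>i\<in>{1..m}. fs i) \<and> (\<forall>i\<in>{1..m}. total_degree (fs i) > 0) \<and>
          \<not> p dvd card {v. \<forall>i\<in>{1..m}. eval_at v (fs i) = 0}) \<longrightarrow>
       (\<forall>I. constructible (principal_ideal_of f) I \<longrightarrow> radical_ideal I))"
proof -
  define t where "t = Poly_Mapping.lookup (Tr (f ^ (p - 1))) 0"
  have n: "n \<ge> 1" using assms(1) by (simp add: Suc_leI)
  have p: "p \<ge> 2" using prime_ge_2_nat[OF prime_card[where 'a='p]] assms(2) by simp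
  have Tr_t: "Tr (f ^ (p - 1)) = Const t"
    using Tr_eq_Const[of f] assms unfolding t_def by simp
  have sign: "(-1) ^ (n + m) = ((-1) ^ (n - m) :: 'p mod_ring)" if "m \<le> n" for m
  proof -
    have "n + m = (n - m) + 2 * m" using that by simp
    then show ?thesis by (simp only: power_add power_mult) simp
  qed
  \<comment> \<open>The family with the single member \<open>f\<close>: its only proper subproduct is 1, of degree \<open>0 < n\<close>.\<close>
  have count: "of_nat (card {v. eval_at v f = 0}) = (-1) ^ (n - 1) * t"
  proof -
    have "of_nat (card {v. \<forall>i\<in>{()}. eval_at v f = 0}) = (-1) ^ (CARD('n) + card {()})
        * Poly_Mapping.lookup (Tr ((\<Prod>i\<in>{()}. f) ^ (CARD('p) - 1))) 0"
    proof (rule card_common_zeros)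
      fix S assume "S \<subset> {()}"
      then have "S = {}" by auto
      then show "total_degree (\<Prod>i\<in>S. f) < CARD('n)" by simp
    qed (use assms in simp_all)
    then have "of_nat (card {v. eval_at v f = 0}) = (-1) ^ (n + 1) * t"
      using assms by (simp add: t_def)
    then show ?thesis by (simp only: sign[OF n])
  qed
  have counts: "of_nat (card {v. \<forall>i\<in>{1..m}. eval_at v (fs i) = 0}) = (-1) ^ (n - m) * t"
    if "f = (\<Prod>i\<in>{1..m}. fs i)" "\<forall>i\<in>{1..m}. total_degree (fs i) > 0" for m and fs :: "nat \<Rightarrow> ('n, 'p) fpoly"
  proof -
    have "m \<le> n"
      using card_le_total_degree_prod[of "{1..m}" fs] that assms(3) by simp
    moreover have "of_nat (card {v. \<forall>i\<in>{1..m}. eval_at v (fs i) = 0}) = (-1) ^ (CARD('n) + card {1..m})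
        * Poly_Mapping.lookup (Tr ((\<Prod>i\<in>{1..m}. fs i) ^ (CARD('p) - 1))) 0"
    proof (rule card_common_zeros)
      show "total_degree (\<Prod>i\<in>{1..m}. fs i) \<le> CARD('n)" using that(1) assms by simp
      show "total_degree (\<Prod>i\<in>S. fs i) < CARD('n)" if S: "S \<subset> {1..m}" for S
        using subproduct_degree_less[OF _ _ S, of fs] \<open>f = _\<close> \<open>\<forall>i\<in>_. _\<close> assms by simp
    qed simp
    ultimately show ?thesis
      using sign[of m] assms(1,2) that(1) by (simp add: t_def)
  qed
  have dvd_iff: "p dvd k \<longleftrightarrow> (of_nat k :: 'p mod_ring) = 0" for k
    using of_nat_eq_0_iff_char_dvd[where 'a="'p mod_ring", of k] assms(2) by simp
  let ?\<phi> = "\<lambda>g. Const (inverse t) * Tr (f ^ (p - 1) * g)"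
  have split: "splitting p ?\<phi>" "compatibly_split ?\<phi> (principal_ideal_of f)" if "t \<noteq> 0"
    using splitting_of_nonzero_trace[of f t] Tr_t that assms(2) by simp_all
  have degree: "total_degree f = n" if "t \<noteq> 0"
  proof (rule ccontr)
    assume "total_degree f \<noteq> n"
    then show False
      using lookup_Tr_eq_0_of_small_degree[of f] that assms by (simp add: t_def)
  qed
  have radical: "radical_ideal I" if "t \<noteq> 0" "constructible (principal_ideal_of f) I" for I
    using constructible_compatibly_split[OF split(1) p split(2) that(2)]
      compatibly_split_imp_radical[OF split(1) p] that(1) by blast
  have a: "Const (of_nat (card {v. eval_at v f = 0})) = (-1) ^ (n - 1) * Tr (f ^ (p - 1))"
    by (simp only: count Tr_t Const_sign)
  have b: "(\<exists>c. splitting p (\<lambda>g. Const c * Tr (f ^ (p - 1) * g)) \<and>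
      compatibly_split (\<lambda>g. Const c * Tr (f ^ (p - 1) * g)) (principal_ideal_of f)) \<and> total_degree f = n"
    if "\<not> p dvd card {v. eval_at v f = 0}"
  proof -
    have "t \<noteq> 0" using that by (auto simp: dvd_iff count)
    then show ?thesis using split degree by blast
  qed
  have c: "Const (of_nat (card {v. \<forall>i\<in>{1..m}. eval_at v (fs i) = 0})) = (-1) ^ (n - m) * Tr (f ^ (p - 1))"
    if "f = (\<Prod>i\<in>{1..m}. fs i) \<and> (\<forall>i\<in>{1..m}. total_degree (fs i) > 0)"
    for m and fs :: "nat \<Rightarrow> ('n, 'p) fpoly"
  proof -
    have "of_nat (card {v. \<forall>i\<in>{1..m}. eval_at v (fs i) = 0}) = (-1) ^ (n - m) * t"
      using that by (intro counts) auto
    then show ?thesis by (simp only: Tr_t Const_sign)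
  qed
  have d: "radical_ideal I"
    if "\<not> p dvd card {v. eval_at v f = 0} \<or>
       (\<exists>(m::nat) fs. f = (\<Prod>i\<in>{1..m}. fs i) \<and> (\<forall>i\<in>{1..m}. total_degree (fs i) > 0) \<and>
          \<not> p dvd card {v. \<forall>i\<in>{1..m}. eval_at v (fs i) = 0})"
      "constructible (principal_ideal_of f) I" for I
  proof -
    have "t \<noteq> 0" using that(1)
    proof
      assume "\<not> p dvd card {v. eval_at v f = 0}"
      then show ?thesis by (auto simp: dvd_iff count)
    next
      assume "\<exists>(m::nat) fs. f = (\<Prod>i\<in>{1..m}. fs i) \<and> (\<forall>i\<in>{1..m}. total_degree (fs i) > 0) \<and>
          \<not> p dvd card {v. \<forall>i\<in>{1..m}. eval_at v (fs i) = 0}"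
      then obtain m :: nat and fs where *: "f = (\<Prod>i\<in>{1..m}. fs i)" "\<forall>i\<in>{1..m}. total_degree (fs i) > 0"
        and "\<not> p dvd card {v. \<forall>i\<in>{1..m}. eval_at v (fs i) = 0}" by blast
      then show ?thesis unfolding dvd_iff counts[OF *] by auto
    qed
    then show ?thesis using radical that(2) by blast
  qed
  show ?thesis using a b c d by blast
qed

end
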